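(* Let $q\in\mathbb Q_{>0}$, $a,b\in\mathbb N$ and $m,n\in\mathbb Z$. Assume that $q(ax+n)(by+m)\neq q(bx+m)(ay+n)$ as polynomials in $x,y$. Then the pattern $$x,\quad y,\quad q(ax+n)(by+m),\quad q(bx+m)(ay+n)$$ is partition regular if and only if the pattern $$x,\quad y,\quad (x+qbn)(y+qam),\quad (x+qam)(y+qbn)$$ is partition regular and there is $t\in\mathbb Z$ such that at least one of the following holds: (a) $qam=t^2$, $qbn=(t+1)^2$ and $\dfrac{am+bn}{2ab}-\dfrac{1}{2qab}\in\mathbb Z$; (b) $qam=t(t-1)$, $qbn=t(t+1)$ and $\dfrac{am+bn}{2ab}\in\mathbb Z$.
   Context: $\mathbb N$ denotes the set of positive integers ($0\notin\mathbb N$). A pattern $f_1(x,y),\dots,f_k(x,y)$ (with the $f_i$ rational-valued functions) is called partition regular if, for every finite colouring (partition into finitely many pieces) of $\mathbb N$, the set of monochromatic $k$-tuples $(f_1(u,v),\dots,f_k(u,v))$ with $u,v\in\mathbb N$ is infinite; here a tuple is monochromatic if all its entries belong to $\mathbb N$ and lie in the same colour. *)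

theory Defs
  imports Complex_Main "HOL-Library.Disjoint_Sets" "HOL-Computational_Algebra.Polynomial"
begin

(* The positive integers are the set {0<..} of type nat.  The functions are rational-valued, so a
   tuple is monochromatic only if all its entries are (images of) positive integers, all in one cell. *)
definition monochromatic :: "nat set set \<Rightarrow> rat list \<Rightarrow> bool" where
  "monochromatic P ts \<longleftrightarrow> (\<exists>C\<in>P. set ts \<subseteq> of_nat ` C)"

definition partition_regular :: "(nat \<Rightarrow> nat \<Rightarrow> rat) list \<Rightarrow> bool" where
  "partition_regular fs \<longleftrightarrow>
    (\<forall>P. finite P \<and> partition_on {0<..} P \<longrightarrow>
      infinite {ts. (\<exists>u>0. \<exists>v>0. ts = map (\<lambda>f. f u v) fs) \<and> monochromatic P ts})"

(* Q[x,y] is represented as Q[x][y]: the inner indeterminate is x, the outer one is y. *)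
definition varX :: "rat poly poly" where "varX = [:[:0, 1:]:]"

definition varY :: "rat poly poly" where "varY = [:0, 1:]"

end

theory Submission imports Defs "HOL-Number_Theory.Cong"
begin

text \<open>
  Put \<open>\<alpha> = qab\<close>, \<open>r = qbn\<close>, \<open>s = qam\<close>. The first pattern is \<open>x, y, z, w\<close> with
  \<open>\<alpha>z = (\<alpha>x + r)(\<alpha>y + s)\<close> and \<open>\<alpha>w = (\<alpha>x + s)(\<alpha>y + r)\<close>, the second one is the case
  \<open>\<alpha> = 1\<close>, and the hypothesis says \<open>r \<noteq> s\<close>. Such a pattern can only be partition regular
  if \<open>{r, s} = {0, 1}\<close>; this forces (a) with \<open>t = 0\<close> or \<open>t = -1\<close>, and for these \<open>r\<close> and \<open>s\<close>
  partition regularity does not depend on \<open>\<alpha>\<close>, because \<open>z\<close> or \<open>w\<close> is \<open>\<alpha>xy + x\<close> and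
  colouring by residues makes \<open>x\<close> as divisible as needed for a rescaling.

  To exclude the other \<open>r, s\<close>, clear denominators (\<open>N\<close>) and pass to the coordinate
  \<open>u = 2\<alpha>x + r + s - N\<close> (similarly \<open>v, z, w\<close>), centred between the two solutions
  \<open>u\<^sup>2 = D\<close> of \<open>x = y = z = w\<close>. With \<open>c = r - s\<close> the equations become
  \<open>2Nz = uv + (N - c)u + (N + c)v - D\<close> and \<open>2Nw = uv + (N + c)u + (N - c)v - D\<close>.
  Fix a large prime \<open>p\<close> and colour by residue and last nonzero \<open>p\<close>-adic digit of \<open>u\<^sup>2 - D\<close>
  (of \<open>u\<close> if \<open>D = 0\<close>). Comparing last digits settles everything except two cases in which \<open>u\<close>
  and \<open>v\<close> have the same distance \<open>p\<^sup>-\<^sup>k\<close> to a solution. If \<open>D = 0\<close>, write \<open>u = p\<^sup>kU\<close>: then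
  \<open>uv\<close> changes the digit of \<open>z\<close> at position \<open>2k\<close>, which is detected by colouring with the
  approximate position of \<open>U\<close> in the circle of integers modulo \<open>p\<^sup>k\<^sup>+\<^sup>1\<close>. If \<open>D = N\<^sup>2\<close>, then
  \<open>z\<close> or \<open>w\<close> has distance \<open>p\<^sup>-\<^sup>2\<^sup>k\<close>, which is detected by the parity of the 2-adic valuation of \<open>k\<close>.
\<close>

section \<open>Last nonzero \<open>p\<close>-adic digits\<close>

definition last_digit :: "int \<Rightarrow> int \<Rightarrow> int" where
  "last_digit p u = (u div p ^ multiplicity p u) mod p"

lemma multiplicity_last_digit:
  fixes p u U :: int
  assumes "prime p" "u = p ^ k * U" "\<not> p dvd U"
  shows "multiplicity p u = k" "last_digit p u = U mod p"
proof -
  have p0: "p \<noteq> 0" "\<not> is_unit p" using assms(1) by (auto dest: not_prime_unit)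
  show m: "multiplicity p u = k"
    using assms p0 by (intro multiplicity_eqI) (auto simp: power_Suc2 mult.commute)
  show "last_digit p u = U mod p"
    unfolding last_digit_def m using assms(2) p0 by simp
qed

lemma prime_power_decomp:
  fixes p u :: int
  assumes "prime p" "u \<noteq> 0"
  obtains U where "u = p ^ multiplicity p u * U" "\<not> p dvd U"
  using multiplicity_decompose'[of u p] assms not_prime_unit by blast

lemma last_digit_eq_0_iff:
  fixes p u :: int
  assumes "prime p"
  shows "last_digit p u = 0 \<longleftrightarrow> u = 0"
proof
  assume 0: "last_digit p u = 0"
  show "u = 0"
  proof (rule ccontr)
    assume "u \<noteq> 0"
    then obtain U where "u = p ^ multiplicity p u * U" "\<not> p dvd U"
      using prime_power_decomp assms by blast
    then show False using multiplicity_last_digit(2)[OF assms, of u "multiplicity p u" U] 0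
      by (simp add: mod_eq_0_iff_dvd)
  qed
qed (simp add: last_digit_def)

text \<open>\<open>M * z\<close> and \<open>A * u\<close> agree through the last nonzero digit of
  \<open>A * u\<close>, so \<open>z\<close> inherits the valuation of \<open>u\<close>, and the
  cofactors satisfy \<open>M * Z = A * U\<close> modulo \<open>p\<close>; equal last digits then
  cancel. Most contradictions below arise this way: for large \<open>p\<close>, two distinct fixed
  coefficients cannot have ratio 1.\<close>

lemma last_digit_ratio:
  fixes p u z A M :: int
  assumes p: "prime p" and u: "u \<noteq> 0" and M: "\<not> p dvd M" and A: "\<not> p dvd A"
    and c: "p ^ Suc (multiplicity p u) dvd M * z - A * u"
    and d: "last_digit p z = last_digit p u"
  shows "multiplicity p z = multiplicity p u" "p dvd A - M"
proof -
  define k where "k = multiplicity p u"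
  obtain U where U: "u = p ^ k * U" "\<not> p dvd U"
    using prime_power_decomp p u unfolding k_def by blast
  have p0: "p \<noteq> 0" using p by auto
  obtain j where j: "M * z - A * u = p ^ Suc k * j" using c unfolding k_def by blast
  have "p ^ k dvd M * z"
  proof -
    have "M * z = p ^ k * (A * U + p * j)" using j U by (simp add: algebra_simps)
    then show ?thesis by simp
  qed
  moreover have "coprime (p ^ k) M" using p M by (simp add: prime_imp_coprime)
  ultimately obtain Z where Z: "z = p ^ k * Z"
    using coprime_dvd_mult_right_iff by blast
  have "p ^ k * (M * Z) = p ^ k * (A * U + p * j)" using j U Z by (simp add: algebra_simps)
  then have MZ: "M * Z = A * U + p * j" using p0 by simp
  have "\<not> p dvd A * U" using p A U(2) by (simp add: prime_dvd_mult_iff)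
  then have nZ: "\<not> p dvd Z" using MZ
    by (metis dvd_add_left_iff dvd_mult dvd_triv_left)
  note z = multiplicity_last_digit[OF p Z nZ]
  show "multiplicity p z = multiplicity p u" using z(1) k_def by simp
  have "Z mod p = U mod p"
    using z(2) multiplicity_last_digit(2)[OF p U] d by simp
  then have "p dvd Z - U" by (simp add: mod_eq_dvd_iff)
  then obtain i where "Z = U + p * i" by (metis add.commute diff_add_cancel dvdE)
  then have "(A - M) * U = p * (M * i - j)" using MZ by (simp add: algebra_simps)
  then have "p dvd (A - M) * U" by simp
  then show "p dvd A - M" using p U(2) by (simp add: prime_dvd_mult_iff)
qed

lemma not_dvd_large:
  fixes p x :: int
  assumes "x \<noteq> 0" "\<bar>x\<bar> < p"
  shows "\<not> p dvd x"
  using assms by (meson dvd_imp_le_int not_less abs_ge_self order.trans le_less_trans)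

lemma ex_large_prime: "\<exists>p::int. prime p \<and> B < p"
proof -
  obtain p where "prime p" "nat B < p" using bigger_prime by blast
  then show ?thesis by (intro exI[of _ "int p"]) auto
qed

section \<open>The case \<open>D = 0\<close>: arcs on circles of residues, and the double
  root\<close>

lemma quotient_eq_imp_close:
  fixes A B P Q :: int
  assumes "P > 0" "A * Q div P = B * Q div P"
  shows "\<bar>A - B\<bar> * \<bar>Q\<bar> < P"
proof -
  have "A * Q = (A * Q div P) * P + A * Q mod P" "B * Q = (B * Q div P) * P + B * Q mod P"
    by simp_all
  then have "A * Q - B * Q = A * Q mod P - B * Q mod P" using assms(2)
    by (metis add_diff_cancel_left)
  moreover have "0 \<le> A * Q mod P" "A * Q mod P < P" "0 \<le> B * Q mod P" "B * Q mod P < P"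
    using assms(1) by simp_all
  ultimately have "\<bar>A * Q - B * Q\<bar> < P" by linarith
  then show ?thesis by (simp add: abs_mult[symmetric] left_diff_distrib)
qed

text \<open>For \<open>u = p^k * U\<close> the circle of residues modulo \<open>p^(k+1)\<close> is
  cut into \<open>Q\<close> arcs, and \<open>U\<close> is coloured by its arc. The modulus grows
  with \<open>k\<close> in order to see digit \<open>k\<close>, where
  \<open>u * v = p^k * (p^k * U * V)\<close> enters, while the number of colours stays
  bounded.\<close>

definition phase :: "int \<Rightarrow> int \<Rightarrow> int \<Rightarrow> int" where
  "phase p Q u = (let k = multiplicity p u in
     ((u div p ^ k) mod p ^ Suc k) * Q div p ^ Suc k)"

lemma phase_range:
  assumes "prime p" "Q > 0"
  shows "phase p Q u \<in> {0..Q}"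
proof -
  define P where "P = p ^ Suc (multiplicity p u)"
  define r where "r = (u div p ^ multiplicity p u) mod P"
  have P: "P > 0" using assms prime_gt_0_int unfolding P_def by simp
  then have "0 \<le> r" "r < P" unfolding r_def by simp_all
  then have "0 \<le> r * Q" "r * Q \<le> P * Q" using assms by (auto intro: mult_right_mono)
  then have "0 \<le> r * Q div P" "r * Q div P \<le> P * Q div P"
    using P zdiv_mono1 pos_imp_zdiv_nonneg_iff by blast+
  moreover have "P * Q div P = Q" using P by simp
  ultimately show ?thesis unfolding phase_def Let_def P_def r_def by simp
qed

lemma phase_eq_imp_close:
  fixes p u v :: int
  assumes p: "prime p" and "u = p ^ k * U" "\<not> p dvd U" "v = p ^ k * V" "\<not> p dvd V"
    and "phase p Q u = phase p Q v"
  obtains d where "p ^ Suc k dvd V - U - d" "\<bar>d\<bar> * \<bar>Q\<bar> < p ^ Suc k"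
proof -
  let ?P = "p ^ Suc k"
  have P: "?P > 0" using p prime_gt_0_int by simp
  have "p ^ k \<noteq> 0" using p by auto
  then have "(U mod ?P) * Q div ?P = (V mod ?P) * Q div ?P"
    using assms multiplicity_last_digit(1)[OF p assms(2,3)] multiplicity_last_digit(1)[OF p assms(4,5)]
    by (simp add: phase_def)
  then have "\<bar>V mod ?P - U mod ?P\<bar> * \<bar>Q\<bar> < ?P"
    using quotient_eq_imp_close[OF P] by (metis)
  moreover have "?P dvd V - U - (V mod ?P - U mod ?P)"
  proof -
    have "V - U - (V mod ?P - U mod ?P) = ?P * (V div ?P - U div ?P)"
      by (simp add: minus_mod_eq_mult_div[symmetric] right_diff_distrib del: power_Suc)
    then show ?thesis by simp
  qed
  ultimately show ?thesis using that by blast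
qed

text \<open>If the valuations of \<open>u\<close> and \<open>v\<close> differ, the smaller one fixes
  the last digit of \<open>2N z\<close> with coefficient \<open>N - c\<close> or
  \<open>N + c\<close>; equality with \<open>2N\<close> would make \<open>p\<close> divide
  \<open>N + c\<close> or \<open>N - c\<close>. If they agree, the linear part is consistent, and
  the phases contradict the term \<open>u * v\<close>.\<close>

lemma double_root_colouring:
  fixes N c :: int
  assumes N: "N > 0" and c: "c \<noteq> N" "c \<noteq> - N"
  shows "\<exists>\<kappa>::int \<Rightarrow> int \<times> int \<times> int. finite (range \<kappa>) \<and>
    (\<forall>u v z. \<kappa> u = \<kappa> v \<and> \<kappa> u = \<kappa> z \<and> 2 * N * z = u * v + (N - c) * u + (N + c) * v \<longrightarrow> u = 0)"
proof -
  obtain p :: int where p: "prime p" and pl: "2 * N + \<bar>c\<bar> < p" using ex_large_prime by blast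
  have nd: "\<not> p dvd 2 * N" "\<not> p dvd N - c" "\<not> p dvd N + c"
    using not_dvd_large[of _ p] N c pl by auto
  \<comment> \<open>Differences below \<open>p^(k+1) / Q\<close>, weighted by \<open>2N\<close> and
    \<open>|N + c|\<close>, must add up to less than \<open>p^k\<close>.\<close>
  define Q where "Q = p * (2 * N + \<bar>N + c\<bar>)"
  have p0: "p > 0" using p prime_gt_0_int by blast
  have Q: "Q > 0" using p0 N unfolding Q_def by (simp add: add_pos_nonneg)
  define \<kappa> where "\<kappa> u = (u mod p, last_digit p u, phase p Q u)" for u
  have "range \<kappa> \<subseteq> {0..<p} \<times> {0..<p} \<times> {0..Q}"
    using phase_range[OF p Q] p0 unfolding \<kappa>_def last_digit_def by auto
  then have fin: "finite (range \<kappa>)" by (rule finite_subset) simp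
  have "u = 0" if col: "\<kappa> u = \<kappa> v" "\<kappa> u = \<kappa> z"
    and eq: "2 * N * z = u * v + (N - c) * u + (N + c) * v" for u v z
  proof (rule ccontr)
    assume u0: "u \<noteq> 0"
    have m: "p dvd u - v" "p dvd u - z" and l: "last_digit p v = last_digit p u" "last_digit p z = last_digit p u"
      and ph: "phase p Q u = phase p Q v" "phase p Q u = phase p Q z"
      using col unfolding \<kappa>_def prod.inject mod_eq_dvd_iff by simp_all
    have v0: "v \<noteq> 0" using u0 l last_digit_eq_0_iff[OF p] by metis
    have z0: "z \<noteq> 0" using u0 l last_digit_eq_0_iff[OF p] by metis
    \<comment> \<open>Modulo \<open>p\<close> the numbers \<open>u\<close>, \<open>v\<close>,
      \<open>z\<close> coincide, and the equation collapses to \<open>u^2 = 0\<close>.\<close>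
    have "u * u = (u + N + c) * (u - v) - 2 * N * (u - z)"
      using eq by (simp add: algebra_simps)
    moreover have "p dvd \<dots>" using m by (intro dvd_diff) auto
    ultimately have "p dvd u * u" by simp
    then have pu: "p dvd u" using p by (simp add: prime_dvd_mult_iff)
    define k where "k = multiplicity p u"
    define j where "j = multiplicity p v"
    obtain U where U: "u = p ^ k * U" "\<not> p dvd U"
      using prime_power_decomp p u0 unfolding k_def by blast
    obtain V where V: "v = p ^ j * V" "\<not> p dvd V"
      using prime_power_decomp p v0 unfolding j_def by blast
    consider "k < j" | "j < k" | "k = j" by linarith
    then show False
    proof cases
      case 1
      have "p ^ Suc k dvd v" using 1 V by (metis Suc_leI dvd_mult2 le_imp_power_dvd)
      moreover have "2 * N * z - (N - c) * u = v * (u + N + c)" using eq by (simp add: algebra_simps)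
      ultimately have "p ^ Suc k dvd 2 * N * z - (N - c) * u" by (simp only: dvd_mult2)
      then have "p dvd (N - c) - 2 * N"
        using last_digit_ratio(2)[OF p u0 nd(1,2) _ l(2)] unfolding k_def by blast
      moreover have "N + c = - ((N - c) - 2 * N)" by simp
      ultimately show False using nd by (metis dvd_minus_iff)
    next
      case 2
      have "p ^ Suc j dvd u" using 2 U by (metis Suc_leI dvd_mult2 le_imp_power_dvd)
      moreover have "2 * N * z - (N + c) * v = u * (v + N - c)" using eq by (simp add: algebra_simps)
      ultimately have "p ^ Suc j dvd 2 * N * z - (N + c) * v" by (simp only: dvd_mult2)
      then have "p dvd (N + c) - 2 * N"
        using last_digit_ratio(2)[OF p v0 nd(1,3)] l unfolding j_def by metis
      moreover have "N - c = - ((N + c) - 2 * N)" by simp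
      ultimately show False using nd by (metis dvd_minus_iff)
    next
      case 3
      have V: "v = p ^ k * V" using V 3 by simp
      have nV: "\<not> p dvd V" by fact
      have "U mod p = V mod p"
        using multiplicity_last_digit(2)[OF p U] multiplicity_last_digit(2)[OF p V nV] l by simp
      then have "p dvd V - U" by (metis mod_eq_dvd_iff)
      then have "p ^ k * p dvd p ^ k * (V - U)" by (rule mult_dvd_mono[OF dvd_refl])
      moreover have "v - u = p ^ k * (V - U)" using U V by (simp add: right_diff_distrib)
      ultimately have "p ^ Suc k dvd v - u" by (simp only: power_Suc2)
      moreover have "p ^ Suc k dvd u * v"
        using pu V by (metis mult_dvd_mono dvd_triv_left power_Suc)
      moreover have "2 * N * z - 2 * N * u = u * v + (N + c) * (v - u)"
        using eq by (simp add: algebra_simps)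
      ultimately have "p ^ Suc k dvd 2 * N * z - 2 * N * u" by (simp only: dvd_add dvd_mult)
      then have "multiplicity p z = k"
        using last_digit_ratio(1)[OF p u0 nd(1) nd(1) _ l(2)] unfolding k_def by blast
      then obtain Z where Z: "z = p ^ k * Z" "\<not> p dvd Z"
        using prime_power_decomp p z0 by metis
      obtain d where d: "p ^ Suc k dvd V - U - d" "\<bar>d\<bar> * \<bar>Q\<bar> < p ^ Suc k"
        using phase_eq_imp_close[OF p U V nV ph(1)] by blast
      obtain e where e: "p ^ Suc k dvd Z - U - e" "\<bar>e\<bar> * \<bar>Q\<bar> < p ^ Suc k"
        using phase_eq_imp_close[OF p U Z ph(2)] by blast
      \<comment> \<open>Modulo \<open>p^(k+1)\<close>, \<open>p^k * U * V\<close> is congruent to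
        \<open>f\<close>. As a combination of the small differences \<open>e\<close> and
        \<open>d\<close>, \<open>f\<close> is below \<open>p^k\<close> in size; being divisible by
        \<open>p^k\<close> it is 0, and then \<open>p\<close> divides \<open>U * V\<close>.\<close>
      define f where "f = 2 * N * e - (N + c) * d"
      have "p ^ k * (2 * N * Z) = p ^ k * (p ^ k * U * V + (N - c) * U + (N + c) * V)"
        using eq U V Z by (simp add: algebra_simps)
      then have "2 * N * Z = p ^ k * U * V + (N - c) * U + (N + c) * V"
        using p0 by simp
      then have "p ^ k * (U * V) - f = 2 * N * (Z - U - e) - (N + c) * (V - U - d)"
        unfolding f_def by (simp add: algebra_simps)
      then have fd: "p ^ Suc k dvd p ^ k * (U * V) - f"
        using d e by (metis dvd_diff dvd_mult)
      have "\<bar>f\<bar> * Q < p ^ k * Q"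
      proof -
        have "\<bar>f\<bar> \<le> 2 * N * \<bar>e\<bar> + \<bar>N + c\<bar> * \<bar>d\<bar>"
          unfolding f_def using N abs_triangle_ineq4[of "2 * N * e" "(N + c) * d"]
          by (simp add: abs_mult)
        then have "\<bar>f\<bar> * Q \<le> (2 * N * \<bar>e\<bar> + \<bar>N + c\<bar> * \<bar>d\<bar>) * Q"
          using Q by (simp add: mult_right_mono)
        also have "\<dots> = 2 * N * (\<bar>e\<bar> * \<bar>Q\<bar>) + \<bar>N + c\<bar> * (\<bar>d\<bar> * \<bar>Q\<bar>)"
          using Q by (simp add: algebra_simps)
        also have "\<dots> < 2 * N * p ^ Suc k + \<bar>N + c\<bar> * p ^ Suc k"
          using d(2) e(2) N by (intro add_less_le_mono mult_left_mono mult_strict_left_mono) auto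
        also have "\<dots> = p ^ k * Q" unfolding Q_def by (simp add: algebra_simps)
        finally show ?thesis .
      qed
      then have fs: "\<bar>f\<bar> < p ^ k" using Q by simp
      have "p ^ k dvd p ^ k * (U * V) - f" using fd by (metis dvd_mult_right power_Suc)
      then have "p ^ k dvd f" by (simp add: dvd_diff_right_iff)
      then have "f = 0" using fs not_dvd_large by blast
      then have "p dvd U * V" using fd p0 by (simp add: mult.commute[of p])
      then show False using p U nV by (simp add: prime_dvd_mult_iff)
    qed
  qed
  then show ?thesis using fin by blast
qed


section \<open>The case \<open>D \<noteq> 0\<close>: simple roots\<close>

lemma square_minus_cong:
  fixes p u v z N c D :: int
  assumes p: "prime p" "\<not> p dvd 2 * N" and u: "\<not> p dvd u"
    and uv: "p dvd u - v" and k: "k \<ge> 1" "p ^ k dvd u\<^sup>2 - D" "p ^ k dvd v\<^sup>2 - D"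
    and eq: "2 * N * z = u * v + (N - c) * u + (N + c) * v - D"
  shows "p ^ Suc k dvd 2 * N * (z\<^sup>2 - D) - ((u + N - c) * (u\<^sup>2 - D) + (u + N + c) * (v\<^sup>2 - D))"
proof -
  \<comment> \<open>\<open>v + u\<close> is congruent to \<open>2u\<close>, a unit modulo
    \<open>p\<close>, so \<open>p^k\<close> divides \<open>v - u\<close> as soon as it divides
    \<open>v^2 - u^2\<close>.\<close>
  have "\<not> p dvd 2" using p by (meson dvd_mult2)
  then have "\<not> p dvd 2 * u" using p u by (simp add: prime_dvd_mult_iff)
  moreover have "v + u = 2 * u - (u - v)" by simp
  ultimately have "\<not> p dvd v + u" using uv by (metis dvd_diff_left_iff)
  then have "coprime (p ^ k) (v + u)" using p by (simp add: prime_imp_coprime)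
  moreover have "(v\<^sup>2 - D) - (u\<^sup>2 - D) = (v + u) * (v - u)" by (simp add: algebra_simps power2_eq_square)
  then have "p ^ k dvd (v + u) * (v - u)" using k by (metis dvd_diff)
  ultimately have d: "p ^ k dvd v - u" using coprime_dvd_mult_right_iff by blast
  have T: "2 * N * (z - u) = (u\<^sup>2 - D) + (u + N + c) * (v - u)"
    using eq by (simp add: algebra_simps power2_eq_square)
  then have "p ^ k dvd 2 * N * (z - u)" using k d by (metis dvd_add dvd_mult)
  moreover have "coprime (p ^ k) (2 * N)" using p prime_imp_coprime by (metis coprime_power_left_iff)
  ultimately have z: "p ^ k dvd z - u" using coprime_dvd_mult_right_iff by blast
  have sq: "p ^ Suc k dvd A * B" if "p ^ k dvd A" "p ^ k dvd B" for A B :: int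
  proof -
    have "p ^ Suc k dvd p ^ (k + k)" using k(1) by (intro le_imp_power_dvd) simp
    then show ?thesis using mult_dvd_mono[OF that] by (metis dvd_trans power_add)
  qed
  \<comment> \<open>Expanding around \<open>u\<close>, the first-order terms cancel by
    \<open>T\<close>. What remains are products of two differences divisible by \<open>p^k\<close>,
    and \<open>2k >= k + 1\<close>.\<close>
  have "2 * N * (z\<^sup>2 - D) - ((u + N - c) * (u\<^sup>2 - D) + (u + N + c) * (v\<^sup>2 - D))
      = 2 * N * ((z - u) * (z - u)) + 2 * u * (2 * N * (z - u)) + 2 * N * (u\<^sup>2 - D)
        - ((u + N - c) * (u\<^sup>2 - D) + (u + N + c) * (v\<^sup>2 - D))"
    by (simp add: algebra_simps power2_eq_square)
  also have "\<dots> = 2 * N * ((z - u) * (z - u)) - (u + N + c) * ((v - u) * (v - u))"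
    unfolding T by (simp add: algebra_simps power2_eq_square)
  finally show ?thesis using sq d z by (metis dvd_diff dvd_mult)
qed

text \<open>The valuation of \<open>H u = u^2 - D\<close> measures closeness to a root, and
  \<open>square_minus_cong\<close> expresses \<open>H z\<close> and \<open>H w\<close> through
  \<open>H u\<close> and \<open>H v\<close> to one further digit. Unequal valuations of
  \<open>H u\<close> and \<open>H v\<close> contradict the \<open>z\<close> and \<open>w\<close>
  ratios jointly; equal ones force \<open>u = -N\<close> modulo \<open>p\<close> and
  \<open>D = N^2\<close>, where the parity colour decides.\<close>

lemma simple_roots_colouring:
  fixes N c D :: int
  assumes N: "N > 0" and c: "c \<noteq> 0" and D: "D \<noteq> 0"
  shows "\<exists>\<kappa>::int \<Rightarrow> int \<times> int \<times> int. finite (range \<kappa>) \<and>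
    (\<forall>u v z w. \<kappa> u = \<kappa> v \<and> \<kappa> u = \<kappa> z \<and> \<kappa> u = \<kappa> w
       \<and> 2 * N * z = u * v + (N - c) * u + (N + c) * v - D
       \<and> 2 * N * w = u * v + (N + c) * u + (N - c) * v - D \<longrightarrow> u\<^sup>2 = D)"
proof -
  obtain p :: int where p: "prime p" and pl: "2 * N + 2 * \<bar>c\<bar> + \<bar>D\<bar> + \<bar>D - N\<^sup>2\<bar> < p"
    using ex_large_prime by blast
  have p0: "p > 0" using p prime_gt_0_int by blast
  have nd: "\<not> p dvd 2 * N" "\<not> p dvd 2 * c" "\<not> p dvd D"
    using not_dvd_large[of _ p] N c D pl by auto
  have "\<bar>D - N\<^sup>2\<bar> < p" using pl N by linarith
  then have ndN: "D = N\<^sup>2" if "p dvd D - N\<^sup>2"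
    using not_dvd_large[of "D - N\<^sup>2" p] that by auto
  have nd2: "\<not> p dvd 2" using nd by (meson dvd_mult2)
  define H where "H u = u\<^sup>2 - D" for u
  \<comment> \<open>Doubling a positive \<open>k\<close> raises its 2-adic valuation by one, so the
    third component separates valuation \<open>k\<close> from \<open>2k\<close> using two
    colours.\<close>
  define \<kappa> where "\<kappa> u = (u mod p, last_digit p (H u), int (multiplicity 2 (multiplicity p (H u)) mod 2))" for u
  have "range \<kappa> \<subseteq> {0..<p} \<times> {0..<p} \<times> {0..<2}"
    using p0 unfolding \<kappa>_def last_digit_def by auto
  then have fin: "finite (range \<kappa>)" by (rule finite_subset) simp
  have common: "p dvd H u \<and> \<not> p dvd u" if "p dvd u - v" "p dvd u - z"
    "2 * N * z = u * v + (N - c) * u + (N + c) * v - D" for u v z c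
  proof -
    have "H u = (u + N + c) * (u - v) - 2 * N * (u - z)"
      using that unfolding H_def by (simp add: algebra_simps power2_eq_square)
    then have "p dvd H u" using that by simp
    moreover have "D = u * u - H u" unfolding H_def by (simp add: power2_eq_square)
    ultimately show ?thesis using nd(3) by (metis dvd_diff dvd_mult2)
  qed
  have unequal: False if col: "\<kappa> u = \<kappa> v" "\<kappa> u = \<kappa> z" "\<kappa> u = \<kappa> w"
    and eqs: "2 * N * z = u * v + (N - c) * u + (N + c) * v - D"
      "2 * N * w = u * v + (N + c) * u + (N - c) * v - D"
    and H0: "H u \<noteq> 0" "H v \<noteq> 0" and lt: "multiplicity p (H u) < multiplicity p (H v)" for u v z w
  proof -
    define k where "k = multiplicity p (H u)"
    have m: "p dvd u - v" "p dvd u - z" and l: "last_digit p (H z) = last_digit p (H u)"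
        "last_digit p (H w) = last_digit p (H u)"
      using col unfolding \<kappa>_def prod.inject mod_eq_dvd_iff by simp_all
    have pu: "p dvd H u" "\<not> p dvd u" using common[OF m eqs(1)] by auto
    have k1: "k \<ge> 1" unfolding k_def using pu H0 p
      by (metis One_nat_def Suc_leI multiplicity_gt_zero_iff not_prime_unit)
    have Hu: "p ^ k dvd H u" unfolding k_def by (rule multiplicity_dvd)
    have Hv: "p ^ Suc k dvd H v" using lt unfolding k_def by (intro multiplicity_dvd') simp
    then have Hv': "p ^ k dvd H v" by (metis dvd_mult_right power_Suc)
    \<comment> \<open>The \<open>H v\<close> term is negligible here, so the coefficient
      \<open>u + N - e\<close> of \<open>H u\<close> either vanishes modulo \<open>p\<close> or
      equals \<open>2N\<close>. It is applied with \<open>e = c\<close> for \<open>z\<close> and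
      \<open>e = -c\<close> for \<open>w\<close>.\<close>
    have step: "p dvd u + N - e \<or> p dvd u - N - e"
      if e: "2 * N * y = u * v + (N - e) * u + (N + e) * v - D" "last_digit p (H y) = last_digit p (H u)" for e y
    proof (rule disjCI)
      assume "\<not> p dvd u - N - e"
      show "p dvd u + N - e"
      proof (rule ccontr)
        assume n: "\<not> p dvd u + N - e"
        have "p ^ Suc k dvd 2 * N * H y - ((u + N - e) * H u + (u + N + e) * H v)"
          using square_minus_cong[OF p nd(1) pu(2) m(1) k1 Hu[unfolded H_def] Hv'[unfolded H_def] e(1)]
          unfolding H_def .
        moreover have "2 * N * H y - (u + N - e) * H u
            = 2 * N * H y - ((u + N - e) * H u + (u + N + e) * H v) + (u + N + e) * H v" by simp
        ultimately have "p ^ Suc k dvd 2 * N * H y - (u + N - e) * H u"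
          using Hv by (metis dvd_add dvd_mult)
        then have "p dvd (u + N - e) - 2 * N"
          using last_digit_ratio(2)[OF p H0(1) nd(1) n _ e(2)] unfolding k_def by blast
        then show False using \<open>\<not> p dvd u - N - e\<close> by (simp add: algebra_simps)
      qed
    qed
    have A: "p dvd u + N - c \<or> p dvd u - N - c" using step[OF eqs(1) l(1)] .
    have B: "p dvd u + N + c \<or> p dvd u - N + c" using step[of w "- c"] eqs(2) l(2) by simp
    \<comment> \<open>Each of the four combinations of \<open>A\<close> and \<open>B\<close> leaves
      \<open>2u\<close> or \<open>2c\<close> after adding or subtracting.\<close>
    have "p dvd 2 * u \<or> p dvd 2 * c"
    proof -
      have "p dvd (u + N - c) + (u - N + c) \<or> p dvd (u - N - c) + (u + N + c)
          \<or> p dvd (u + N + c) - (u + N - c) \<or> p dvd (u - N + c) - (u - N - c)"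
        using A B dvd_add dvd_diff by blast
      then show ?thesis by simp
    qed
    then show False using nd(2) nd2 pu(2) p by (simp add: prime_dvd_mult_iff)
  qed
  have "H u = 0" if col: "\<kappa> u = \<kappa> v" "\<kappa> u = \<kappa> z" "\<kappa> u = \<kappa> w"
    and eqs: "2 * N * z = u * v + (N - c) * u + (N + c) * v - D"
      "2 * N * w = u * v + (N + c) * u + (N - c) * v - D" for u v z w
  proof (rule ccontr)
    assume H0: "H u \<noteq> 0"
    have m: "p dvd u - v" "p dvd u - z" "p dvd u - w"
      and l: "last_digit p (H v) = last_digit p (H u)" "last_digit p (H z) = last_digit p (H u)"
        "last_digit p (H w) = last_digit p (H u)"
      using col unfolding \<kappa>_def prod.inject mod_eq_dvd_iff by simp_all
    have H1: "H v \<noteq> 0" "H z \<noteq> 0" "H w \<noteq> 0" using H0 l last_digit_eq_0_iff[OF p] by metis+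
    have col': "\<kappa> v = \<kappa> u" "\<kappa> v = \<kappa> w" "\<kappa> v = \<kappa> z" using col by simp_all
    \<comment> \<open>Exchanging \<open>u\<close> and \<open>v\<close> exchanges \<open>z\<close>
      and \<open>w\<close>, so \<open>unequal\<close> rules out both orders.\<close>
    have eqs': "2 * N * w = v * u + (N - c) * v + (N + c) * u - D"
      "2 * N * z = v * u + (N + c) * v + (N - c) * u - D"
      using eqs by (simp_all only: ac_simps)
    have "\<not> multiplicity p (H v) < multiplicity p (H u)"
      using unequal[OF col' eqs' H1(1) H0] by blast
    moreover have "\<not> multiplicity p (H u) < multiplicity p (H v)"
      using unequal[OF col eqs H0 H1(1)] by blast
    ultimately have eqm: "multiplicity p (H v) = multiplicity p (H u)" by simp
    have pu: "p dvd H u" "\<not> p dvd u" using common[OF m(1,2) eqs(1)] by auto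
    define k where "k = multiplicity p (H u)"
    have k1: "k \<ge> 1" unfolding k_def using pu H0 p
      by (metis One_nat_def Suc_leI multiplicity_gt_zero_iff not_prime_unit)
    obtain U where U: "H u = p ^ k * U" "\<not> p dvd U"
      using prime_power_decomp p H0 unfolding k_def by blast
    obtain V where V: "H v = p ^ k * V" "\<not> p dvd V"
      using prime_power_decomp p H1(1) eqm unfolding k_def by metis
    have "U mod p = V mod p"
      using multiplicity_last_digit(2)[OF p U] multiplicity_last_digit(2)[OF p V] l by simp
    then have UV: "p dvd V - U" by (metis mod_eq_dvd_iff)
    then have "p ^ k * p dvd p ^ k * (V - U)" by (rule mult_dvd_mono[OF dvd_refl])
    moreover have "H v - H u = p ^ k * (V - U)" using U V by (simp add: right_diff_distrib)
    ultimately have HvHu: "p ^ Suc k dvd H v - H u" by (simp only: power_Suc2)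
    \<comment> \<open>\<open>H u\<close> and \<open>H v\<close> agree modulo \<open>p^(k+1)\<close>,
      so their coefficients add up to \<open>2u + 2N\<close>. If this were a unit, it would have to
      equal \<open>2N\<close> modulo \<open>p\<close>, although \<open>2u\<close> is a unit.\<close>
    have "p dvd u + N"
    proof (rule ccontr)
      assume "\<not> p dvd u + N"
      then have n: "\<not> p dvd 2 * u + 2 * N" using nd2 p
        by (metis distrib_left prime_dvd_mult_iff)
      have "p ^ k dvd H u" "p ^ k dvd H v" using U V by simp_all
      then have "p ^ Suc k dvd 2 * N * H z - ((u + N - c) * H u + (u + N + c) * H v)"
        using square_minus_cong[OF p nd(1) pu(2) m(1) k1 _ _ eqs(1)] unfolding H_def by blast
      moreover have "2 * N * H z - (2 * u + 2 * N) * H u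
         = 2 * N * H z - ((u + N - c) * H u + (u + N + c) * H v) + (u + N + c) * (H v - H u)"
        by (simp add: algebra_simps)
      ultimately have "p ^ Suc k dvd 2 * N * H z - (2 * u + 2 * N) * H u"
        using HvHu by (metis dvd_add dvd_mult)
      then have "p dvd 2 * u + 2 * N - 2 * N"
        using last_digit_ratio(2)[OF p H0 nd(1) n _ l(2)] unfolding k_def by blast
      then show False using nd2 pu(2) p by (simp add: prime_dvd_mult_iff)
    qed
    moreover have "D - N\<^sup>2 = (u + N) * (u - N) - H u" unfolding H_def
      by (simp add: algebra_simps power2_eq_square)
    ultimately have DN: "D = N\<^sup>2" using ndN pu(1) by (metis dvd_diff dvd_mult2)
    \<comment> \<open>\<open>e x\<close> is the displacement from the root \<open>-N\<close>. Close
      to it the other factor of \<open>H x\<close> is a unit congruent to \<open>-2N\<close>, so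
      valuation and last digit of \<open>H x\<close> can be read off \<open>e x\<close>.\<close>
    define e where "e x = x + N" for x
    have He: "H x = e x * (e x - 2 * N)" for x
      unfolding H_def e_def DN by (simp add: algebra_simps power2_eq_square)
    have pe: "p dvd e u" using \<open>p dvd u + N\<close> unfolding e_def .
    have pex: "p dvd e x" if "p dvd u - x" for x
      using dvd_diff[OF pe that] unfolding e_def by (simp add: add.commute)
    have val: "multiplicity p (e x) = multiplicity p (H x)
       \<and> (\<exists>X. e x = p ^ multiplicity p (H x) * X \<and> \<not> p dvd X
              \<and> p dvd - 2 * N * X - last_digit p (H x))"
      if "p dvd u - x" "H x \<noteq> 0" for x
    proof -
      define j where "j = multiplicity p (e x)"
      have ex: "e x \<noteq> 0" using that He by auto
      obtain X where X: "e x = p ^ j * X" "\<not> p dvd X"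
        using prime_power_decomp p ex unfolding j_def by blast
      have "\<not> p dvd e x - 2 * N" using nd(1) pex[OF that(1)] by (simp add: dvd_diff_right_iff)
      then have n: "\<not> p dvd X * (e x - 2 * N)" using X p by (simp add: prime_dvd_mult_iff)
      have HX: "H x = p ^ j * (X * (e x - 2 * N))" using He X by simp
      note mh = multiplicity_last_digit[OF p HX n]
      have "p dvd X * (e x - 2 * N) - last_digit p (H x)"
        unfolding mh(2) by (simp add: minus_mod_eq_mult_div)
      moreover have "- 2 * N * X - last_digit p (H x)
          = X * (e x - 2 * N) - last_digit p (H x) - X * e x" by (simp add: algebra_simps)
      ultimately have "p dvd - 2 * N * X - last_digit p (H x)"
        using pex[OF that(1)] by (metis dvd_diff dvd_mult)
      then show ?thesis using X mh(1) j_def by auto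
    qed
    have e_eqs: "2 * N * e z = e u * e v + c * (e v - e u)"
      "2 * N * e w = e u * e v - c * (e v - e u)"
      using eqs unfolding e_def DN by (simp_all add: algebra_simps power2_eq_square)
    obtain U' where U': "e u = p ^ k * U'" "\<not> p dvd U'" using val[of u] H0 unfolding k_def by auto
    obtain V' where V': "e v = p ^ k * V'" "\<not> p dvd V'"
      using val[OF m(1) H1(1)] eqm unfolding k_def by auto
    have prod: "e u * e v = p ^ (k + k) * (U' * V')" "\<not> p dvd U' * V'"
      using U' V' p by (simp_all add: power_add prime_dvd_mult_iff)
    define i where "i = multiplicity p (H z)"
    define j where "j = multiplicity p (H w)"
    obtain Z where Z: "e z = p ^ i * Z" "\<not> p dvd Z" "p dvd - 2 * N * Z - last_digit p (H u)"
      using val[OF m(2) H1(2)] l unfolding i_def by auto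
    obtain W where W: "e w = p ^ j * W" "\<not> p dvd W" "p dvd - 2 * N * W - last_digit p (H u)"
      using val[OF m(3) H1(3)] l unfolding j_def by auto
    have par: "multiplicity 2 i mod 2 = multiplicity 2 k mod 2" "multiplicity 2 j mod 2 = multiplicity 2 k mod 2"
      using col unfolding \<kappa>_def i_def j_def k_def by simp_all
    have par2: "multiplicity 2 (k + k) mod 2 \<noteq> multiplicity 2 k mod 2"
    proof -
      have "multiplicity 2 (2 * k) = Suc (multiplicity 2 k)"
        using k1 by (intro multiplicity_times_same) auto
      then show ?thesis by (simp add: mult_2) presburger
    qed
    have ij: "i \<noteq> k + k" "j \<noteq> k + k" using par par2 by auto
    \<comment> \<open>Adding \<open>e_eqs\<close> cancels the \<open>c\<close> terms, so the sum has
      valuation exactly \<open>2k\<close>. Since \<open>Z\<close> and \<open>W\<close> agree modulo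
      \<open>p\<close>, they cannot cancel, and that valuation is \<open>min i j\<close>; but parity
      excludes \<open>2k\<close> for both.\<close>
    have sum: "N * (e z + e w) = p ^ (k + k) * (U' * V')"
      using e_eqs prod by (simp add: algebra_simps)
    have nN: "\<not> p dvd N" using nd(1) by (meson dvd_mult)
    have ZW: "\<not> p dvd Z + W"
    proof
      assume "p dvd Z + W"
      moreover have "4 * N * Z = (- 2 * N * W - last_digit p (H u)) - (- 2 * N * Z - last_digit p (H u)) + 2 * N * (Z + W)"
        by (simp add: algebra_simps)
      ultimately have "p dvd 2 * (2 * N) * Z" using Z(3) W(3)
        by (metis (no_types, lifting) dvd_add dvd_diff dvd_mult mult.assoc mult_2 numeral_Bit0 distrib_right)
      then show False using nd2 nd(1) Z(2) p by (simp only: prime_dvd_mult_iff) blast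
    qed
    have "multiplicity p (N * (e z + e w)) = min i j"
    proof -
      consider "i < j" | "j < i" | "i = j" by linarith
      then show ?thesis
      proof cases
        case 1
        then obtain d where d: "j = i + Suc d" by (metis less_imp_Suc_add add_Suc_right)
        have "N * (e z + e w) = p ^ i * (N * (Z + p * (p ^ d * W)))"
          unfolding Z W d by (simp add: algebra_simps power_add)
        moreover have "\<not> p dvd N * (Z + p * (p ^ d * W))" using nN Z(2) p
          by (simp add: prime_dvd_mult_iff dvd_add_left_iff)
        ultimately have "multiplicity p (N * (e z + e w)) = i" by (rule multiplicity_last_digit(1)[OF p])
        then show ?thesis using 1 by simp
      next
        case 2
        then obtain d where d: "i = j + Suc d" by (metis less_imp_Suc_add add_Suc_right)
        have "N * (e z + e w) = p ^ j * (N * (W + p * (p ^ d * Z)))"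
          unfolding Z W d by (simp add: algebra_simps power_add)
        moreover have "\<not> p dvd N * (W + p * (p ^ d * Z))" using nN W(2) p
          by (simp add: prime_dvd_mult_iff dvd_add_left_iff)
        ultimately have "multiplicity p (N * (e z + e w)) = j" by (rule multiplicity_last_digit(1)[OF p])
        then show ?thesis using 2 by simp
      next
        case 3
        have "N * (e z + e w) = p ^ i * (N * (Z + W))"
          unfolding Z W 3 by (simp add: algebra_simps)
        moreover have "\<not> p dvd N * (Z + W)" using nN ZW p by (simp add: prime_dvd_mult_iff)
        ultimately have "multiplicity p (N * (e z + e w)) = i" by (rule multiplicity_last_digit(1)[OF p])
        then show ?thesis using 3 by simp
      qed
    qed
    moreover have "multiplicity p (N * (e z + e w)) = k + k"
      using multiplicity_last_digit(1)[OF p sum prod(2)] .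
    ultimately show False using ij by (auto simp: min_def split: if_splits)
  qed
  then show ?thesis using fin unfolding H_def by (intro exI[of _ \<kappa>]) auto
qed

text \<open>In the coordinates used for the pattern, the excluded combination of \<open>D\<close>
  and \<open>c\<close> means exactly \<open>{r, s} = {0, 1}\<close>.\<close>

lemma fixed_points_colouring:
  fixes N c D :: int
  assumes "N > 0" "c \<noteq> 0" "\<not> (D = 0 \<and> (c = N \<or> c = - N))"
  obtains \<kappa> :: "int \<Rightarrow> int \<times> int \<times> int" where "finite (range \<kappa>)"
    "\<And>u v z w. \<lbrakk>\<kappa> u = \<kappa> v; \<kappa> u = \<kappa> z; \<kappa> u = \<kappa> w;
       2 * N * z = u * v + (N - c) * u + (N + c) * v - D;
       2 * N * w = u * v + (N + c) * u + (N - c) * v - D\<rbrakk> \<Longrightarrow> u\<^sup>2 = D"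
proof (cases "D = 0")
  case True
  then obtain \<kappa> :: "int \<Rightarrow> int \<times> int \<times> int" where fin: "finite (range \<kappa>)"
    and \<kappa>: "\<forall>u v z. \<kappa> u = \<kappa> v \<and> \<kappa> u = \<kappa> z \<and> 2 * N * z = u * v + (N - c) * u + (N + c) * v \<longrightarrow> u = 0"
    using double_root_colouring[of N c] assms by blast
  show ?thesis
  proof (rule that[OF fin])
    fix u v z
    assume "\<kappa> u = \<kappa> v" "\<kappa> u = \<kappa> z" "2 * N * z = u * v + (N - c) * u + (N + c) * v - D"
    then have "u = 0" using \<kappa> True by (metis diff_zero)
    then show "u\<^sup>2 = D" using True by simp
  qed
next
  case False
  then obtain \<kappa> :: "int \<Rightarrow> int \<times> int \<times> int" where "finite (range \<kappa>)"
    "\<forall>u v z w. \<kappa> u = \<kappa> v \<and> \<kappa> u = \<kappa> z \<and> \<kappa> u = \<kappa> w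
       \<and> 2 * N * z = u * v + (N - c) * u + (N + c) * v - D
       \<and> 2 * N * w = u * v + (N + c) * u + (N - c) * v - D \<longrightarrow> u\<^sup>2 = D"
    using simple_roots_colouring[of N c D] assms by blast
  then show ?thesis by (intro that[of \<kappa>]) blast+
qed

section \<open>Partition regularity in terms of finite colourings\<close>

definition mono_pairs :: "(nat \<Rightarrow> 'c) \<Rightarrow> (nat \<Rightarrow> nat \<Rightarrow> rat) \<Rightarrow> (nat \<Rightarrow> nat \<Rightarrow> rat) \<Rightarrow> (nat \<times> nat) set" where
  "mono_pairs \<kappa> g h = {(x, y). x > 0 \<and> y > 0 \<and> \<kappa> y = \<kappa> x \<and>
     (\<exists>z w. z > 0 \<and> w > 0 \<and> g x y = of_nat z \<and> h x y = of_nat w \<and> \<kappa> z = \<kappa> x \<and> \<kappa> w = \<kappa> x)}"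

lemma partition_regular4D:
  assumes pr: "partition_regular [\<lambda>x y. of_nat x, \<lambda>x y. of_nat y, g, h]" and fin: "finite (range \<kappa>)"
  shows "infinite (mono_pairs \<kappa> g h)"
proof
  assume f: "finite (mono_pairs \<kappa> g h)"
  define P where "P = (\<lambda>c. {n::nat. 0 < n \<and> \<kappa> n = c}) ` (\<kappa> ` {0<..})"
  have "finite P" unfolding P_def using fin by (meson finite_imageI finite_subset image_mono subset_UNIV)
  moreover have "partition_on {0<..} P"
    unfolding partition_on_def P_def disjoint_def by auto
  ultimately have inf: "infinite {ts. (\<exists>u>0. \<exists>v>0. ts = map (\<lambda>f. f u v) [\<lambda>x y. of_nat x, \<lambda>x y. of_nat y, g, h])
      \<and> monochromatic P ts}" (is "infinite ?T") using pr unfolding partition_regular_def by blast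
  have "?T \<subseteq> (\<lambda>(x, y). [of_nat x, of_nat y, g x y, h x y]) ` mono_pairs \<kappa> g h"
  proof
    fix ts assume "ts \<in> ?T"
    then obtain u v c where uv: "u > 0" "v > 0" "ts = [of_nat u, of_nat v, g u v, h u v]"
      and "set ts \<subseteq> of_nat ` {n. 0 < n \<and> \<kappa> n = c}"
      unfolding monochromatic_def P_def by auto
    then have "(u, v) \<in> mono_pairs \<kappa> g h" unfolding mono_pairs_def by auto
    then show "ts \<in> (\<lambda>(x, y). [of_nat x, of_nat y, g x y, h x y]) ` mono_pairs \<kappa> g h"
      using uv(3) by force
  qed
  then show False using f inf by (meson finite_imageI finite_subset)
qed

lemma partition_regular4I:
  assumes "\<And>\<kappa>::nat \<Rightarrow> nat set. finite (range \<kappa>) \<Longrightarrow> infinite (mono_pairs \<kappa> g h)"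
  shows "partition_regular [\<lambda>x y. of_nat x, \<lambda>x y. of_nat y, g, h]"
  unfolding partition_regular_def
proof (intro allI impI)
  fix P :: "nat set set"
  assume P: "finite P \<and> partition_on {0<..} P"
  \<comment> \<open>Each positive integer is coloured by its own cell; 0 lies in no cell and gets
    the default \<open>{}\<close>.\<close>
  define \<kappa> where "\<kappa> n = \<Union>{C \<in> P. n \<in> C}" for n
  have cell: "\<kappa> n = C" if "C \<in> P" "n \<in> C" for n C
  proof -
    have "{C \<in> P. n \<in> C} = {C}"
      using P that unfolding partition_on_def disjoint_def by blast
    then show ?thesis unfolding \<kappa>_def by simp
  qed
  have ex: "\<kappa> n \<in> P \<and> n \<in> \<kappa> n" if "n > 0" for n
  proof -
    have "n \<in> \<Union>P" using P that unfolding partition_on_def by auto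
    then show ?thesis using cell by auto
  qed
  have "range \<kappa> \<subseteq> insert {} P"
  proof
    fix C assume "C \<in> range \<kappa>"
    then obtain n where n: "C = \<kappa> n" by blast
    show "C \<in> insert {} P"
    proof (cases "\<exists>A\<in>P. n \<in> A")
      case True
      then show ?thesis using cell n by auto
    next
      case False
      then show ?thesis using n unfolding \<kappa>_def by auto
    qed
  qed
  then have "finite (range \<kappa>)" using P finite_subset by blast
  then have inf: "infinite (mono_pairs \<kappa> g h)" by (rule assms)
  let ?f = "\<lambda>(x, y). [of_nat x, of_nat y, g x y, h x y]"
  have "inj_on ?f (mono_pairs \<kappa> g h)" by (auto simp: inj_on_def)
  then have "infinite (?f ` mono_pairs \<kappa> g h)" using inf finite_imageD by blast
  moreover have "?f ` mono_pairs \<kappa> g h \<subseteq> {ts. (\<exists>u>0. \<exists>v>0. ts = map (\<lambda>f. f u v)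
      [\<lambda>x y. of_nat x, \<lambda>x y. of_nat y, g, h]) \<and> monochromatic P ts}"
  proof clarify
    fix x y assume "(x, y) \<in> mono_pairs \<kappa> g h"
    then obtain z w where 1: "x > 0" "y > 0" "z > 0" "w > 0" "\<kappa> y = \<kappa> x" "\<kappa> z = \<kappa> x" "\<kappa> w = \<kappa> x"
        "g x y = of_nat z" "h x y = of_nat w" unfolding mono_pairs_def by blast
    then have "{x, y, z, w} \<subseteq> \<kappa> x" "\<kappa> x \<in> P" using ex by (metis empty_subsetI insert_subset) (use ex 1 in blast)
    then have "monochromatic P [of_nat x, of_nat y, g x y, h x y]"
      unfolding monochromatic_def using 1 by (intro bexI[of _ "\<kappa> x"]) auto
    then show "(\<exists>u>0. \<exists>v>0. [of_nat x, of_nat y, g x y, h x y] = map (\<lambda>f. f u v)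
      [\<lambda>x y. of_nat x, \<lambda>x y. of_nat y, g, h]) \<and> monochromatic P [of_nat x, of_nat y, g x y, h x y]"
      using 1 by auto
  qed
  ultimately show "infinite {ts. (\<exists>u>0. \<exists>v>0. ts = map (\<lambda>f. f u v)
      [\<lambda>x y. of_nat x, \<lambda>x y. of_nat y, g, h]) \<and> monochromatic P ts}"
    using finite_subset by blast
qed

section \<open>Excluding all \<open>{r, s}\<close> other than \<open>{0, 1}\<close>\<close>

definition shifted_product :: "rat \<Rightarrow> rat \<Rightarrow> rat \<Rightarrow> nat \<Rightarrow> nat \<Rightarrow> rat" where
  "shifted_product \<alpha> r s x y = (\<alpha> * of_nat x + r) * (\<alpha> * of_nat y + s) / \<alpha>"

abbreviation shifted_product_pattern :: "rat \<Rightarrow> rat \<Rightarrow> rat \<Rightarrow> (nat \<Rightarrow> nat \<Rightarrow> rat) list" where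
  "shifted_product_pattern \<alpha> r s \<equiv>
     [\<lambda>x y. of_nat x, \<lambda>x y. of_nat y, shifted_product \<alpha> r s, shifted_product \<alpha> s r]"

lemma common_denominator:
  fixes x y z :: rat
  obtains N a b c :: int where "N > 0" "of_int a = of_int N * x" "of_int b = of_int N * y" "of_int c = of_int N * z"
proof -
  have *: "\<exists>a d. d > 0 \<and> of_int a = of_int d * x" for x :: rat
    by (cases x) (auto simp: Fract_of_int_quotient intro!: exI)
  obtain a d b e c f where "d > 0" "of_int a = of_int d * x" "e > 0" "of_int b = of_int e * y"
    "f > 0" "of_int c = of_int f * z" using *[of x] *[of y] *[of z] by blast
  then show ?thesis by (intro that[of "d * e * f" "a * e * f" "b * d * f" "c * d * e"]) simp_all
qed

text \<open>The injective affine map \<open>E\<close> carries the pattern to the equations of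
  \<open>fixed_points_colouring\<close>. Monochromatic pairs then have both coordinates among the
  finitely many solutions of \<open>(E n)^2 = D\<close>.\<close>

lemma shifted_product_colouring:
  fixes \<alpha> r s :: rat
  assumes \<alpha>: "\<alpha> > 0" and rs: "r \<noteq> s" "{r, s} \<noteq> {0, 1}"
  obtains \<kappa> :: "nat \<Rightarrow> int \<times> int \<times> int" where "finite (range \<kappa>)"
    "finite (mono_pairs \<kappa> (shifted_product \<alpha> r s) (shifted_product \<alpha> s r))"
proof -
  obtain N a0 r0 s0 where N: "N > 0" and den: "of_int a0 = of_int N * \<alpha>"
    "of_int r0 = of_int N * r" "of_int s0 = of_int N * s"
    using common_denominator by metis
  have a0: "a0 > 0"
  proof -
    have "(of_int a0 :: rat) > 0" using den N \<alpha> by simp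
    then show ?thesis by simp
  qed
  define g where "g = r0 + s0 - N"
  define c where "c = r0 - s0"
  \<comment> \<open>This is \<open>N^2\<close> times the discriminant of
    \<open>(T + r)(T + s) - T\<close>, whose roots are the values \<open>T = \<alpha>x\<close> with
    \<open>x = y = z = w\<close>.\<close>
  define D where "D = g\<^sup>2 - 4 * r0 * s0"
  define E where "E n = 2 * a0 * int n + g" for n
  have c0: "c \<noteq> 0"
  proof
    assume "c = 0"
    then have "(of_int r0 :: rat) = of_int s0" unfolding c_def by simp
    then show False using den N rs by simp
  qed
  have Dc: "\<not> (D = 0 \<and> (c = N \<or> c = - N))"
  proof
    assume *: "D = 0 \<and> (c = N \<or> c = - N)"
    \<comment> \<open>This follows from \<open>(r0 + s0)^2 - 4 r0 s0 = c^2\<close> and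
      \<open>r0 + s0 = g + N\<close>.\<close>
    moreover have "D = c\<^sup>2 - N\<^sup>2 - 2 * N * g" unfolding D_def c_def g_def
      by (simp add: algebra_simps power2_eq_square)
    ultimately have "g = 0" using N by auto
    then have "r0 = N \<and> s0 = 0 \<or> r0 = 0 \<and> s0 = N" using * unfolding g_def c_def by linarith
    then have "r = 1 \<and> s = 0 \<or> r = 0 \<and> s = 1" using den N by auto
    then show False using rs by auto
  qed
  \<comment> \<open>\<open>r1\<close>, \<open>s1\<close> stand for \<open>r0\<close>,
    \<open>s0\<close> in either order, which yields both equations; \<open>g\<close> and
    \<open>D\<close> are symmetric in the two.\<close>
  have key: "2 * N * E z = E x * E y + (N - (r1 - s1)) * E x + (N + (r1 - s1)) * E y - D"
    if sp: "shifted_product \<alpha> r' s' x y = of_nat z" and d: "of_int r1 = of_int N * r'" "of_int s1 = of_int N * s'"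
      and e: "r1 + s1 = r0 + s0" "r1 * s1 = r0 * s0" for x y z r1 s1 r' s'
  proof -
    have "(\<alpha> * of_nat x + r') * (\<alpha> * of_nat y + s') = \<alpha> * of_nat z"
      using sp \<alpha> unfolding shifted_product_def by (simp add: field_simps)
    moreover have "(of_int N * \<alpha> * of_nat x + of_int N * r') * (of_int N * \<alpha> * of_nat y + of_int N * s')
       = of_int N * of_int N * ((\<alpha> * of_nat x + r') * (\<alpha> * of_nat y + s'))"
      by (simp add: algebra_simps)
    ultimately have "(of_int N * \<alpha> * of_nat x + of_int N * r') * (of_int N * \<alpha> * of_nat y + of_int N * s')
       = of_int N * (of_int N * \<alpha>) * of_nat z" by (simp only: mult.assoc)
    then have "of_int ((a0 * int x + r1) * (a0 * int y + s1)) = (of_int (N * a0 * int z) :: rat)"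
      using den d by simp
    then have z: "N * a0 * int z = (a0 * int x + r1) * (a0 * int y + s1)" by (simp only: of_int_eq_iff)
    have D: "D = g\<^sup>2 - 4 * r1 * s1" using e unfolding D_def by simp
    have g: "g = r1 + s1 - N" using e unfolding g_def by simp
    have "2 * N * E z = 4 * (N * a0 * int z) + 2 * N * g" unfolding E_def by (simp add: algebra_simps)
    also have "\<dots> = E x * E y + (N - (r1 - s1)) * E x + (N + (r1 - s1)) * E y - D"
      unfolding z E_def D g by (simp add: algebra_simps power2_eq_square)
    finally show ?thesis .
  qed
  obtain \<kappa> :: "int \<Rightarrow> int \<times> int \<times> int" where fin: "finite (range \<kappa>)" and \<kappa>:
    "\<And>u v z w. \<lbrakk>\<kappa> u = \<kappa> v; \<kappa> u = \<kappa> z; \<kappa> u = \<kappa> w;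
       2 * N * z = u * v + (N - c) * u + (N + c) * v - D;
       2 * N * w = u * v + (N + c) * u + (N - c) * v - D\<rbrakk> \<Longrightarrow> u\<^sup>2 = D"
    using fixed_points_colouring[OF N c0 Dc] by metis
  define S where "S = {n. (E n)\<^sup>2 = D}"
  have "{u::int. u\<^sup>2 = D} \<subseteq> {- \<bar>D\<bar>..\<bar>D\<bar>}"
  proof clarsimp
    fix u :: int
    have "\<bar>u\<bar> \<le> \<bar>u\<bar> * \<bar>u\<bar>"
      using mult_left_mono[of 1 "\<bar>u\<bar>" "\<bar>u\<bar>"] by (cases "u = 0") auto
    then have "\<bar>u\<bar> \<le> u\<^sup>2" by (simp add: power2_eq_square)
    then show "- (u\<^sup>2) \<le> u \<and> u \<le> u\<^sup>2" by linarith
  qed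
  then have "finite {u::int. u\<^sup>2 = D}" by (rule finite_subset) simp
  moreover have "inj E" unfolding E_def inj_def using a0 by simp
  ultimately have "finite (E -` {u. u\<^sup>2 = D})" by (rule finite_vimageI)
  then have finS: "finite S" unfolding S_def by (simp add: vimage_def)
  have "mono_pairs (\<kappa> \<circ> E) (shifted_product \<alpha> r s) (shifted_product \<alpha> s r) \<subseteq> S \<times> S"
  proof clarify
    fix x y assume "(x, y) \<in> mono_pairs (\<kappa> \<circ> E) (shifted_product \<alpha> r s) (shifted_product \<alpha> s r)"
    then obtain z w where "(\<kappa> \<circ> E) y = (\<kappa> \<circ> E) x" "(\<kappa> \<circ> E) z = (\<kappa> \<circ> E) x" "(\<kappa> \<circ> E) w = (\<kappa> \<circ> E) x"
      and zw: "shifted_product \<alpha> r s x y = of_nat z" "shifted_product \<alpha> s r x y = of_nat w"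
      unfolding mono_pairs_def by blast
    then have m: "\<kappa> (E x) = \<kappa> (E y)" "\<kappa> (E x) = \<kappa> (E z)" "\<kappa> (E x) = \<kappa> (E w)"
      by simp_all
    have z: "2 * N * E z = E x * E y + (N - c) * E x + (N + c) * E y - D"
      using key[OF zw(1) den(2,3)] unfolding c_def by simp
    have w: "2 * N * E w = E x * E y + (N + c) * E x + (N - c) * E y - D"
      using key[OF zw(2) den(3,2)] unfolding c_def by (simp add: algebra_simps)
    have "(E x)\<^sup>2 = D" using \<kappa>[OF m z w] .
    moreover have "(E y)\<^sup>2 = D"
      by (rule \<kappa>[of "E y" "E x" "E w" "E z"]) (use m z w in \<open>simp_all only: ac_simps\<close>)
    ultimately show "x \<in> S \<and> y \<in> S" unfolding S_def by simp
  qed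
  then have "finite (mono_pairs (\<kappa> \<circ> E) (shifted_product \<alpha> r s) (shifted_product \<alpha> s r))"
    using finS finite_subset by blast
  moreover have "finite (range (\<kappa> \<circ> E))" using fin by (metis finite_subset image_comp image_mono subset_UNIV)
  ultimately show ?thesis using that by blast
qed

theorem partition_regular_shifted_product_imp:
  assumes "\<alpha> > 0" "r \<noteq> s" "partition_regular (shifted_product_pattern \<alpha> r s)"
  shows "{r, s} = {0, 1}"
  using assms shifted_product_colouring partition_regular4D by metis

section \<open>Changing the scale when \<open>{r, s} = {0, 1}\<close>\<close>

lemma rat_of_nat_quotient:
  fixes x :: rat
  assumes "x > 0"
  obtains c d :: nat where "c > 0" "d > 0" "x = of_nat c / of_nat d"
proof (cases x)
  case (Fract a b)
  then have "a > 0" using assms by (simp add: zero_less_Fract_iff)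
  then show ?thesis using Fract that[of "nat a" "nat b"]
    by (simp add: Fract_of_int_quotient of_nat_nat)
qed

text \<open>Multiplication by \<open>\<alpha> / \<beta> = c / d\<close> turns one pattern into the
  other once \<open>d\<close> divides all four entries. Colouring also by residues modulo
  \<open>M = e * d^2\<close> ensures this: one entry is \<open>\<alpha>xy + x\<close>, so
  \<open>M\<close> divides \<open>e * x * y\<close>, hence \<open>d^2\<close> divides
  \<open>x * y\<close>, which is congruent to \<open>x^2\<close>. Thus \<open>d\<close> divides
  \<open>x\<close>, and the common residue passes this on to the other entries.\<close>

lemma partition_regular_shifted_product_rescale:
  assumes \<alpha>: "\<alpha> > 0" and \<beta>: "\<beta> > 0" and rs: "{r, s} = {0, 1}"
    and pr: "partition_regular (shifted_product_pattern \<alpha> r s)"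
  shows "partition_regular (shifted_product_pattern \<beta> r s)"
proof (rule partition_regular4I)
  fix \<chi> :: "nat \<Rightarrow> nat set"
  assume fin: "finite (range \<chi>)"
  obtain c d where cd: "c > 0" "d > 0" "\<alpha> / \<beta> = of_nat c / of_nat d"
    using rat_of_nat_quotient[of "\<alpha> / \<beta>"] \<alpha> \<beta> by auto
  obtain e f where ef: "e > 0" "f > 0" "\<alpha> = of_nat e / of_nat f" using rat_of_nat_quotient[OF \<alpha>] by auto
  define M where "M = e * d\<^sup>2"
  have M: "M > 0" "d dvd M" using cd ef unfolding M_def by (simp_all add: power2_eq_square)
  define \<sigma> where "\<sigma> x = c * (x div d)" for x
  define \<kappa> where "\<kappa> x = (x mod M, \<chi> (\<sigma> x))" for x
  have "range \<kappa> \<subseteq> {..<M} \<times> range \<chi>" unfolding \<kappa>_def using M by auto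
  then have "finite (range \<kappa>)" by (rule finite_subset) (simp add: fin)
  then have inf: "infinite (mono_pairs \<kappa> (shifted_product \<alpha> r s) (shifted_product \<alpha> s r))"
    using partition_regular4D[OF pr] by blast
  have \<sigma>: "of_nat (\<sigma> x) = \<alpha> / \<beta> * (of_nat x :: rat)" if "d dvd x" for x
    using that cd unfolding cd(3) \<sigma>_def by auto
  have \<sigma>_pos: "\<sigma> x > 0" if "d dvd x" "x > 0" for x
    using that cd unfolding \<sigma>_def by (auto simp: dvd_imp_le div_greater_zero_iff)
  have scale: "shifted_product \<beta> r' s' (\<sigma> x) (\<sigma> y) = of_nat (\<sigma> z)"
    if "shifted_product \<alpha> r' s' x y = of_nat z" "d dvd x" "d dvd y" "d dvd z" for r' s' x y z
    using that(1) \<alpha> \<beta> unfolding shifted_product_def \<sigma>[OF that(2)] \<sigma>[OF that(3)] \<sigma>[OF that(4)]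
    by (simp add: field_simps)
  have pair: "d dvd x \<and> d dvd y \<and> (\<sigma> x, \<sigma> y) \<in> mono_pairs \<chi> (shifted_product \<beta> r s) (shifted_product \<beta> s r)"
    if xy: "(x, y) \<in> mono_pairs \<kappa> (shifted_product \<alpha> r s) (shifted_product \<alpha> s r)" for x y
  proof -
    obtain z w where zw: "x > 0" "y > 0" "z > 0" "w > 0" "\<kappa> y = \<kappa> x" "\<kappa> z = \<kappa> x" "\<kappa> w = \<kappa> x"
      "shifted_product \<alpha> r s x y = of_nat z" "shifted_product \<alpha> s r x y = of_nat w"
      using xy unfolding mono_pairs_def by blast
    have m: "y mod M = x mod M" "z mod M = x mod M" "w mod M = x mod M"
      and \<chi>: "\<chi> (\<sigma> y) = \<chi> (\<sigma> x)" "\<chi> (\<sigma> z) = \<chi> (\<sigma> x)" "\<chi> (\<sigma> w) = \<chi> (\<sigma> x)"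
      using zw unfolding \<kappa>_def by auto
    have "r = 0 \<and> s = 1 \<or> s = 0 \<and> r = 1" using rs by (auto simp: doubleton_eq_iff)
    \<comment> \<open>\<open>t\<close> is whichever of \<open>z\<close>, \<open>w\<close> equals
      \<open>\<alpha>xy + x\<close>.\<close>
    then obtain t where t: "t mod M = x mod M" "shifted_product \<alpha> 0 1 x y = of_nat t"
      using zw m by metis
    have "\<alpha> * of_nat t = \<alpha> * (\<alpha> * of_nat x * of_nat y + of_nat x)"
      using t(2) \<alpha> unfolding shifted_product_def by (simp add: field_simps)
    then have "of_nat t = \<alpha> * of_nat x * of_nat y + of_nat x" using \<alpha> by simp
    then have "of_nat e * of_nat x * of_nat y + of_nat f * of_nat x = (of_nat f * of_nat t :: rat)"
      using ef by (simp add: field_simps)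
    then have eq: "e * x * y + f * x = f * t" by (metis of_nat_add of_nat_eq_iff of_nat_mult)
    have "[e * (x * y) + f * x = 0 + f * x] (mod M)"
      using cong_scalar_left[of t x M f] t(1) eq unfolding cong_def by (simp add: mult.assoc)
    then have "M dvd e * (x * y)" by (metis cong_add_rcancel_nat cong_0_iff)
    then have "d\<^sup>2 dvd x * y" using ef unfolding M_def by simp
    moreover have "[x * y = x * x] (mod d\<^sup>2)"
      using m(1) cong_scalar_left[of y x M x] cong_dvd_modulus_nat[of "x * y" "x * x" M "d\<^sup>2"]
      unfolding M_def cong_def by simp
    ultimately have "d\<^sup>2 dvd x\<^sup>2" by (metis cong_dvd_iff power2_eq_square)
    then have dx: "d dvd x" by simp
    have d: "d dvd v" if "v mod M = x mod M" for v
      using dx M(2) that by (metis dvd_mod_iff)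
    have "(\<sigma> x, \<sigma> y) \<in> mono_pairs \<chi> (shifted_product \<beta> r s) (shifted_product \<beta> s r)"
      unfolding mono_pairs_def mem_Collect_eq prod.case
      using \<sigma>_pos[OF dx zw(1)] \<sigma>_pos[OF d[OF m(1)] zw(2)] \<sigma>_pos[OF d[OF m(2)] zw(3)]
        \<sigma>_pos[OF d[OF m(3)] zw(4)] \<chi>
        scale[OF zw(8) dx d[OF m(1)] d[OF m(2)]] scale[OF zw(9) dx d[OF m(1)] d[OF m(3)]]
      by (intro conjI exI[of _ "\<sigma> z"] exI[of _ "\<sigma> w"])
    then show ?thesis using dx d[OF m(1)] by blast
  qed
  let ?f = "\<lambda>(x, y). (\<sigma> x, \<sigma> y)"
  have "inj_on ?f (mono_pairs \<kappa> (shifted_product \<alpha> r s) (shifted_product \<alpha> s r))"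
  proof (rule inj_onI, clarify)
    fix x y x' y'
    assume "(x, y) \<in> mono_pairs \<kappa> (shifted_product \<alpha> r s) (shifted_product \<alpha> s r)"
      "(x', y') \<in> mono_pairs \<kappa> (shifted_product \<alpha> r s) (shifted_product \<alpha> s r)"
      and eq: "\<sigma> x = \<sigma> x'" "\<sigma> y = \<sigma> y'"
    then have "d dvd x" "d dvd y" "d dvd x'" "d dvd y'" using pair by blast+
    then show "x = x' \<and> y = y'" using eq cd unfolding \<sigma>_def by (auto simp: dvd_div_eq_iff)
  qed
  then have "infinite (?f ` mono_pairs \<kappa> (shifted_product \<alpha> r s) (shifted_product \<alpha> s r))"
    using inf finite_imageD by blast
  moreover have "?f ` mono_pairs \<kappa> (shifted_product \<alpha> r s) (shifted_product \<alpha> s r)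
      \<subseteq> mono_pairs \<chi> (shifted_product \<beta> r s) (shifted_product \<beta> s r)" using pair by auto
  ultimately show "infinite (mono_pairs \<chi> (shifted_product \<beta> r s) (shifted_product \<beta> s r))"
    using finite_subset by blast
qed

section \<open>The criterion in the original parameters\<close>

theorem theoremF:
  fixes q :: rat and a b :: nat and m n :: int
  assumes "q > 0" and "a > 0" and "b > 0"
    and "[:[:q:]:] * (of_nat a * varX + of_int n) * (of_nat b * varY + of_int m)
       \<noteq> [:[:q:]:] * (of_nat b * varX + of_int m) * (of_nat a * varY + of_int n)"
  shows "partition_regular
           [\<lambda>x y. of_nat x,
            \<lambda>x y. of_nat y,
            \<lambda>x y. q * (of_nat a * of_nat x + of_int n) * (of_nat b * of_nat y + of_int m),
            \<lambda>x y. q * (of_nat b * of_nat x + of_int m) * (of_nat a * of_nat y + of_int n)]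
     \<longleftrightarrow>
         partition_regular
           [\<lambda>x y. of_nat x,
            \<lambda>x y. of_nat y,
            \<lambda>x y. (of_nat x + q * of_nat b * of_int n) * (of_nat y + q * of_nat a * of_int m),
            \<lambda>x y. (of_nat x + q * of_nat a * of_int m) * (of_nat y + q * of_nat b * of_int n)]
         \<and> (\<exists>t::int.
              (q * of_nat a * of_int m = of_int (t ^ 2)
               \<and> q * of_nat b * of_int n = of_int ((t + 1) ^ 2)
               \<and> (of_nat a * of_int m + of_nat b * of_int n) / (2 * of_nat a * of_nat b)
                  - 1 / (2 * q * of_nat a * of_nat b) \<in> \<int>)
            \<or> (q * of_nat a * of_int m = of_int (t * (t - 1))
               \<and> q * of_nat b * of_int n = of_int (t * (t + 1))
               \<and> (of_nat a * of_int m + of_nat b * of_int n) / (2 * of_nat a * of_nat b)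
                  \<in> (\<int> :: rat set)))"
proof -
  define \<alpha> where "\<alpha> = q * of_nat a * of_nat b"
  define r where "r = q * of_nat b * of_int n"
  define s where "s = q * of_nat a * of_int m"
  have \<alpha>: "\<alpha> > 0" using assms unfolding \<alpha>_def by simp
  have ab: "(of_nat a :: rat) > 0" "(of_nat b :: rat) > 0" using assms by simp_all
  have rs: "r \<noteq> s"
  proof
    assume "r = s"
    then have "of_int (int b * n) = (of_int (int a * m) :: rat)"
      using assms(1) unfolding r_def s_def by simp
    then have "int b * n = int a * m" by (simp only: of_int_eq_iff)
    then have "(of_int (int b * n) :: rat poly poly) = of_int (int a * m)" by simp
    then have "(of_nat b * of_int n :: rat poly poly) = of_nat a * of_int m" by simp
    then have "(of_nat a * varX + of_int n) * (of_nat b * varY + of_int m)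
       = (of_nat b * varX + of_int m) * (of_nat a * varY + of_int n)" by algebra
    then show False using assms(4) by (simp only: mult.assoc)
  qed
  \<comment> \<open>Here \<open>\<alpha>x + r = qb(ax + n)\<close> and
    \<open>\<alpha>y + s = qa(by + m)\<close>, and similarly with \<open>r\<close> and
    \<open>s\<close> exchanged.\<close>
  have pattern1: "[\<lambda>x y. of_nat x, \<lambda>x y. of_nat y,
      \<lambda>x y. q * (of_nat a * of_nat x + of_int n) * (of_nat b * of_nat y + of_int m),
      \<lambda>x y. q * (of_nat b * of_nat x + of_int m) * (of_nat a * of_nat y + of_int n)]
    = shifted_product_pattern \<alpha> r s"
    using ab assms(1) unfolding shifted_product_def \<alpha>_def r_def s_def
    by (simp add: fun_eq_iff field_simps)
  have pattern2: "[\<lambda>x y. of_nat x, \<lambda>x y. of_nat y,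
      \<lambda>x y. (of_nat x + q * of_nat b * of_int n) * (of_nat y + q * of_nat a * of_int m),
      \<lambda>x y. (of_nat x + q * of_nat a * of_int m) * (of_nat y + q * of_nat b * of_int n)]
    = shifted_product_pattern 1 r s"
    unfolding shifted_product_def r_def s_def by (simp add: fun_eq_iff)
  have t: "\<exists>t::int. s = of_int (t ^ 2) \<and> r = of_int ((t + 1) ^ 2)
      \<and> (of_nat a * of_int m + of_nat b * of_int n) / (2 * of_nat a * of_nat b)
         - 1 / (2 * q * of_nat a * of_nat b) \<in> (\<int> :: rat set)" if "{r, s} = {0, 1}"
  proof -
    have sum: "r = 0 \<and> s = 1 \<or> r = 1 \<and> s = 0" using that by (auto simp: doubleton_eq_iff)
    have "(of_nat a * of_int m + of_nat b * of_int n) / (2 * of_nat a * of_nat b)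
         - 1 / (2 * q * of_nat a * of_nat b) = (r + s - 1) / (2 * \<alpha>)"
      using ab assms(1) unfolding \<alpha>_def r_def s_def by (simp add: field_simps)
    also have "\<dots> = 0" using sum by auto
    finally have "(of_nat a * of_int m + of_nat b * of_int n) / (2 * of_nat a * of_nat b)
         - 1 / (2 * q * of_nat a * of_nat b) \<in> (\<int> :: rat set)" by simp
    \<comment> \<open>\<open>t = -1\<close> serves \<open>r = 0\<close>, \<open>s = 1\<close>, and
      \<open>t = 0\<close> serves \<open>r = 1\<close>, \<open>s = 0\<close>.\<close>
    then show ?thesis using sum
      by (elim disjE) (intro exI[of _ "-1"], simp, intro exI[of _ 0], simp)
  qed
  show ?thesis
    unfolding pattern1 pattern2 unfolding r_def[symmetric] s_def[symmetric]
  proof (intro iffI conjI)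
    assume pr: "partition_regular (shifted_product_pattern \<alpha> r s)"
    then have 01: "{r, s} = {0, 1}" using partition_regular_shifted_product_imp \<alpha> rs by blast
    show "partition_regular (shifted_product_pattern 1 r s)"
      using partition_regular_shifted_product_rescale[OF \<alpha> _ 01 pr] by simp
    show "\<exists>t::int.
        s = of_int (t ^ 2) \<and> r = of_int ((t + 1) ^ 2)
          \<and> (of_nat a * of_int m + of_nat b * of_int n) / (2 * of_nat a * of_nat b)
             - 1 / (2 * q * of_nat a * of_nat b) \<in> \<int>
      \<or> s = of_int (t * (t - 1)) \<and> r = of_int (t * (t + 1))
          \<and> (of_nat a * of_int m + of_nat b * of_int n) / (2 * of_nat a * of_nat b) \<in> (\<int> :: rat set)"
      using t[OF 01] by blast
  next
    assume "partition_regular (shifted_product_pattern 1 r s) \<and> (\<exists>t::int.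
        s = of_int (t ^ 2) \<and> r = of_int ((t + 1) ^ 2)
          \<and> (of_nat a * of_int m + of_nat b * of_int n) / (2 * of_nat a * of_nat b)
             - 1 / (2 * q * of_nat a * of_nat b) \<in> \<int>
      \<or> s = of_int (t * (t - 1)) \<and> r = of_int (t * (t + 1))
          \<and> (of_nat a * of_int m + of_nat b * of_int n) / (2 * of_nat a * of_nat b) \<in> (\<int> :: rat set))"
    then have pr: "partition_regular (shifted_product_pattern 1 r s)" by blast
    \<comment> \<open>The exclusion at scale 1 gives \<open>{r, s} = {0, 1}\<close>; rescaling then
      leads from 1 to \<open>\<alpha>\<close>.\<close>
    then have 01: "{r, s} = {0, 1}" using partition_regular_shifted_product_imp[OF zero_less_one rs] by blast
    show "partition_regular (shifted_product_pattern \<alpha> r s)"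
      using partition_regular_shifted_product_rescale[OF _ \<alpha> 01 pr] by simp
  qed
qed

end
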